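(* Let $\mathcal{G}=(B,\psi,A)$ be a quantum graph. The following are equivalent: (1) $A$ is real, i.e. $A(b^* )=A(b)^*$ for all $b\in B$; (2) $A$ is positive; (3) $A$ is completely positive.
   Context: Let $B$ be a finite-dimensional unital $C^*$-algebra with multiplication map $m:B\otimes B\to B$, $m(a\otimes b)=ab$, and unit $1$, and let $\psi$ be a faithful state on $B$. $L^2(B,\psi)$ is $B$ with inner product $\langle x|y\rangle_\psi=\psi(x^*y)$. $m^\dagger:B\to B\otimes B$ is the Hilbert space adjoint of $m$ with respect to the inner products of $\psi\otimes\psi$ and $\psi$. For $\delta>0$, $\psi$ is a $\delta$-form if $mm^\dagger=\delta^2\,\mathrm{id}_B$; then $(B,\psi)$ is called a quantum set. A quantum graph $(B,\psi,A)$ is a quantum set $(B,\psi)$ with a linear operator $A:B\to B$ satisfying $m(A\otimes A)m^\dagger=\delta^2A$. A linear map between $C^*$-algebras is positive if it maps positive semidefinite elements to positive semidefinite elements, and completely positive if $A\otimes\mathrm{id}_{M_n}$ is positive for every positive integer $n$. *)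

theory Defs
  imports Complex_Main "HOL-Library.Poly_Mapping" "HOL-Library.Nonpos_Ints"
    "Jordan_Normal_Form.Matrix"
begin

section \<open>Finite-dimensional C*-algebras\<close>

class complex_vector = ab_group_add +
  fixes scaleC :: "complex \<Rightarrow> 'a \<Rightarrow> 'a"  (infixr "*\<^sub>C" 75)
  assumes scaleC_add_right: "c *\<^sub>C (x + y) = c *\<^sub>C x + c *\<^sub>C y"
    and scaleC_add_left: "(c + d) *\<^sub>C x = c *\<^sub>C x + d *\<^sub>C x"
    and scaleC_scaleC: "c *\<^sub>C d *\<^sub>C x = (c * d) *\<^sub>C x"
    and scaleC_one: "1 *\<^sub>C x = x"

abbreviation clinear :: "('a::complex_vector \<Rightarrow> 'b::complex_vector) \<Rightarrow> bool" where
  "clinear \<equiv> Vector_Spaces.linear scaleC scaleC"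

lemma vector_space_scaleC: "vector_space (scaleC :: complex \<Rightarrow> 'a \<Rightarrow> 'a::complex_vector)"
  by unfold_locales (simp_all add: scaleC_add_right scaleC_add_left scaleC_scaleC scaleC_one)

lemma clinear_iff:
  "clinear f \<longleftrightarrow> (\<forall>x y. f (x + y) = f x + f y) \<and> (\<forall>c x. f (c *\<^sub>C x) = c *\<^sub>C f x)"
  by (simp add: Vector_Spaces.linear_iff vector_space_scaleC)

class complex_star_algebra = complex_vector + ring_1 +
  fixes star :: "'a \<Rightarrow> 'a"
  assumes mult_scaleC_left: "(c *\<^sub>C x) * y = c *\<^sub>C (x * y)"
    and mult_scaleC_right: "x * (c *\<^sub>C y) = c *\<^sub>C (x * y)"
    and star_add: "star (x + y) = star x + star y"
    and star_scaleC: "star (c *\<^sub>C x) = cnj c *\<^sub>C star x"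
    and star_mult: "star (x * y) = star y * star x"
    and star_star: "star (star x) = x"

text \<open>Unital C*-algebras. \<^class>\<open>real_normed_algebra_1\<close> demands \<open>norm 1 = 1\<close>, which excludes
  only the zero algebra; the latter carries no state.\<close>

class cstar_algebra = complex_star_algebra + real_normed_algebra_1 + banach +
  assumes scaleR_eq_scaleC: "r *\<^sub>R x = complex_of_real r *\<^sub>C x"
    and norm_scaleC: "norm (c *\<^sub>C x) = cmod c * norm x"
    and norm_star_mult_self: "norm (star x * x) = (norm x)\<^sup>2"

class fd_cstar_algebra = cstar_algebra +
  assumes finite_dimensional: "\<exists>S. finite S \<and> (\<forall>x. \<exists>c. x = (\<Sum>s\<in>S. c s *\<^sub>C s))"

instantiation complex :: fd_cstar_algebra
begin

definition scaleC_complex :: "complex \<Rightarrow> complex \<Rightarrow> complex" where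
  "scaleC_complex = (*)"

definition star_complex :: "complex \<Rightarrow> complex" where
  "star_complex = cnj"

instance
proof
  show "\<exists>S. finite S \<and> (\<forall>x :: complex. \<exists>c. x = (\<Sum>s\<in>S. c s *\<^sub>C s))"
    by (intro exI[of _ "{1}"]) (auto simp: scaleC_complex_def)
qed (simp_all add: scaleC_complex_def star_complex_def algebra_simps norm_mult
      power2_eq_square scaleR_conv_of_real)

end


section \<open>Algebraic tensor products\<close>

text \<open>The tensor product is the free complex vector space on \<open>'a \<times> 'b\<close> modulo the
  congruence generated by bilinearity. The coefficient \<open>c\<close> in the generating rules makes the
  congruence compatible with scalar multiplication.\<close>

inductive tensor_rel ::
  "(('a::complex_vector \<times> 'b::complex_vector) \<Rightarrow>\<^sub>0 complex) \<Rightarrow> (('a \<times> 'b) \<Rightarrow>\<^sub>0 complex) \<Rightarrow> bool"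
  where
    tensor_rel_refl: "tensor_rel f f"
  | tensor_rel_sym: "tensor_rel f g \<Longrightarrow> tensor_rel g f"
  | tensor_rel_trans: "tensor_rel f g \<Longrightarrow> tensor_rel g h \<Longrightarrow> tensor_rel f h"
  | tensor_rel_plus: "tensor_rel f g \<Longrightarrow> tensor_rel f' g' \<Longrightarrow> tensor_rel (f + f') (g + g')"
  | tensor_rel_add_left: "tensor_rel (Poly_Mapping.single (a + a', b) c)
      (Poly_Mapping.single (a, b) c + Poly_Mapping.single (a', b) c)"
  | tensor_rel_add_right: "tensor_rel (Poly_Mapping.single (a, b + b') c)
      (Poly_Mapping.single (a, b) c + Poly_Mapping.single (a, b') c)"
  | tensor_rel_scaleC_left: "tensor_rel (Poly_Mapping.single (z *\<^sub>C a, b) c)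
      (Poly_Mapping.single (a, b) (c * z))"
  | tensor_rel_scaleC_right: "tensor_rel (Poly_Mapping.single (a, z *\<^sub>C b) c)
      (Poly_Mapping.single (a, b) (c * z))"

quotient_type (overloaded) ('a, 'b) tensor =
  "('a::complex_vector \<times> 'b::complex_vector) \<Rightarrow>\<^sub>0 complex" / tensor_rel
  by (intro equivpI reflpI sympI transpI)
    (fact tensor_rel_refl tensor_rel_sym tensor_rel_trans)+

text \<open>Extension of a map on generators with coefficient to the free vector space.\<close>

definition free_extend :: "('p \<Rightarrow> complex \<Rightarrow> 'c) \<Rightarrow> ('p \<Rightarrow>\<^sub>0 complex) \<Rightarrow> 'c::comm_monoid_add"
  where "free_extend h f = (\<Sum>p\<in>Poly_Mapping.keys f. h p (Poly_Mapping.lookup f p))"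

lemma free_extend_superset:
  assumes "\<And>p. h p 0 = 0" "finite S" "Poly_Mapping.keys f \<subseteq> S"
  shows "free_extend h f = (\<Sum>p\<in>S. h p (Poly_Mapping.lookup f p))"
  unfolding free_extend_def
  by (rule sum.mono_neutral_left) (use assms in \<open>auto simp: in_keys_iff\<close>)

lemma free_extend_add:
  assumes "\<And>p. h p 0 = 0" "\<And>p c d. h p (c + d) = h p c + h p d"
  shows "free_extend h (f + g) = free_extend h f + free_extend h g"
proof -
  let ?S = "Poly_Mapping.keys f \<union> Poly_Mapping.keys g"
  have "Poly_Mapping.keys (f + g) \<subseteq> ?S"
    by (rule Poly_Mapping.keys_add)
  then show ?thesis
    by (simp add: free_extend_superset[of h ?S] assms lookup_add sum.distrib)
qed

lemma free_extend_single:
  assumes "h p 0 = 0"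
  shows "free_extend h (Poly_Mapping.single p c) = h p c"
  using assms by (auto simp: free_extend_def)

lemma free_extend_respects:
  assumes "tensor_rel f g"
    and "\<And>p. h p 0 = 0" "\<And>p c d. h p (c + d) = h p c + h p d"
    and "\<And>a a' b c. h (a + a', b) c = h (a, b) c + h (a', b) c"
    and "\<And>a b b' c. h (a, b + b') c = h (a, b) c + h (a, b') c"
    and "\<And>z a b c. h (z *\<^sub>C a, b) c = h (a, b) (c * z)"
    and "\<And>z a b c. h (a, z *\<^sub>C b) c = h (a, b) (c * z)"
  shows "free_extend h f = free_extend h g"
  using assms(1)
  by (induction rule: tensor_rel.induct)
    (simp_all add: free_extend_add free_extend_single assms(2-))

lemma free_induct [case_names zero single add]:
  assumes "P 0" "\<And>p c. P (Poly_Mapping.single p c)" "\<And>f g. P f \<Longrightarrow> P g \<Longrightarrow> P (f + g)"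
  shows "P (f :: 'p \<Rightarrow>\<^sub>0 complex)"
proof (induction f rule: Poly_Mapping.update_induct)
  case const
  then show ?case using assms(1) by simp
next
  case (update f a b)
  have "Poly_Mapping.update a b f = Poly_Mapping.single a b + f"
    using update by (intro poly_mapping_eqI)
      (auto simp: lookup_update lookup_add lookup_single when_def in_keys_iff)
  then show ?case using assms(2,3) update by simp
qed

definition free_scale :: "complex \<Rightarrow> ('p \<Rightarrow>\<^sub>0 complex) \<Rightarrow> ('p \<Rightarrow>\<^sub>0 complex)"
  where "free_scale z = Poly_Mapping.map (\<lambda>c. z * c)"

lemma lookup_free_scale [simp]:
  "Poly_Mapping.lookup (free_scale z f) p = z * Poly_Mapping.lookup f p"
  unfolding free_scale_def by transfer (auto simp: when_def)

lemma free_scale_add: "free_scale z (f + g) = free_scale z f + free_scale z g"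
  by (rule poly_mapping_eqI) (simp add: lookup_add algebra_simps)

lemma free_scale_single:
  "free_scale z (Poly_Mapping.single p c) = Poly_Mapping.single p (z * c)"
  by (rule poly_mapping_eqI) (simp add: lookup_single when_def)

lemma free_scale_respects: "tensor_rel f g \<Longrightarrow> tensor_rel (free_scale z f) (free_scale z g)"
  by (induction rule: tensor_rel.induct)
    (auto simp: free_scale_add free_scale_single mult.assoc[symmetric] intro: tensor_rel.intros)

lemma free_uminus_eq: "- f = free_scale (-1) (f :: 'p \<Rightarrow>\<^sub>0 complex)"
  by (rule poly_mapping_eqI) simp

instantiation tensor :: (complex_vector, complex_vector) complex_vector
begin

lift_definition zero_tensor :: "('a, 'b) tensor" is 0 .

lift_definition plus_tensor :: "('a, 'b) tensor \<Rightarrow> ('a, 'b) tensor \<Rightarrow> ('a, 'b) tensor" is "(+)"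
  by (rule tensor_rel_plus)

lift_definition uminus_tensor :: "('a, 'b) tensor \<Rightarrow> ('a, 'b) tensor" is uminus
  by (simp add: free_uminus_eq free_scale_respects)

lift_definition minus_tensor :: "('a, 'b) tensor \<Rightarrow> ('a, 'b) tensor \<Rightarrow> ('a, 'b) tensor" is "(-)"
  by (metis tensor_rel_plus free_scale_respects free_uminus_eq diff_conv_add_uminus)

lift_definition scaleC_tensor :: "complex \<Rightarrow> ('a, 'b) tensor \<Rightarrow> ('a, 'b) tensor" is free_scale
  by (rule free_scale_respects)

instance
proof
  fix s t u :: "('a, 'b) tensor" and c d :: complex
  have eq: "tensor_rel f g" if "f = g" for f g :: "('a \<times> 'b) \<Rightarrow>\<^sub>0 complex"
    using that tensor_rel_refl by simp
  show "s + t + u = s + (t + u)" by transfer (simp add: eq add.assoc)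
  show "s + t = t + s" by transfer (simp add: eq add.commute)
  show "0 + s = s" by transfer (simp add: eq)
  show "- s + s = 0" by transfer (simp add: eq)
  show "s - t = s + - t" by transfer (simp add: eq)
  show "c *\<^sub>C (s + t) = c *\<^sub>C s + c *\<^sub>C t" by transfer (simp add: eq free_scale_add)
  show "(c + d) *\<^sub>C s = c *\<^sub>C s + d *\<^sub>C s"
    by transfer (rule eq, rule poly_mapping_eqI, simp add: lookup_add algebra_simps)
  show "c *\<^sub>C d *\<^sub>C s = (c * d) *\<^sub>C s"
    by transfer (rule eq, rule poly_mapping_eqI, simp add: mult.assoc)
  show "1 *\<^sub>C s = s"
    by transfer (rule eq, rule poly_mapping_eqI, simp)
qed

end

lift_definition tensor :: "'a::complex_vector \<Rightarrow> 'b::complex_vector \<Rightarrow> ('a, 'b) tensor"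
  (infixr "\<otimes>\<^sub>C" 70)
  is "\<lambda>a b. Poly_Mapping.single (a, b) 1" .

lemma tensor_add_left: "(a + a') \<otimes>\<^sub>C b = a \<otimes>\<^sub>C b + a' \<otimes>\<^sub>C b"
  by transfer (rule tensor_rel_add_left)

lemma tensor_add_right: "a \<otimes>\<^sub>C (b + b') = a \<otimes>\<^sub>C b + a \<otimes>\<^sub>C b'"
  by transfer (rule tensor_rel_add_right)

lemma tensor_scaleC_left: "(z *\<^sub>C a) \<otimes>\<^sub>C b = z *\<^sub>C (a \<otimes>\<^sub>C b)"
  by transfer (metis free_scale_single mult.commute tensor_rel_scaleC_left)

lemma tensor_scaleC_right: "a \<otimes>\<^sub>C (z *\<^sub>C b) = z *\<^sub>C (a \<otimes>\<^sub>C b)"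
  by transfer (metis free_scale_single mult.commute tensor_rel_scaleC_right)

lemma tensor_induct [case_names zero tensor add]:
  assumes "P 0" "\<And>c a b. P (c *\<^sub>C (a \<otimes>\<^sub>C b))" "\<And>s t. P s \<Longrightarrow> P t \<Longrightarrow> P (s + t)"
  shows "P t"
proof -
  have "P (abs_tensor f)" for f
  proof (induction f rule: free_induct)
    case zero
    then show ?case using assms(1) by (simp add: zero_tensor.abs_eq)
  next
    case (single p c)
    have "abs_tensor (Poly_Mapping.single p c) = c *\<^sub>C (fst p \<otimes>\<^sub>C snd p)"
      by (simp add: tensor.abs_eq scaleC_tensor.abs_eq free_scale_single)
    then show ?case using assms(2) by simp
  next
    case (add f g)
    then show ?case using assms(3) by (simp flip: plus_tensor.abs_eq)
  qed
  then show ?thesis by (metis Quotient_abs_rep[OF Quotient_tensor])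
qed

definition cbilinear ::
  "('a::complex_vector \<Rightarrow> 'b::complex_vector \<Rightarrow> 'c::complex_vector) \<Rightarrow> bool"
  where "cbilinear \<beta> \<longleftrightarrow> (\<forall>b. clinear (\<lambda>a. \<beta> a b)) \<and> (\<forall>a. clinear (\<beta> a))"

lemma cbilinearD:
  assumes "cbilinear \<beta>"
  shows "\<beta> (a + a') b = \<beta> a b + \<beta> a' b" "\<beta> a (b + b') = \<beta> a b + \<beta> a b'"
    "\<beta> (z *\<^sub>C a) b = z *\<^sub>C \<beta> a b" "\<beta> a (z *\<^sub>C b) = z *\<^sub>C \<beta> a b"
  using assms by (auto simp: cbilinear_def clinear_iff)

text \<open>The linear map on the tensor product induced by a bilinear map; for maps that are not
  bilinear the value is a dummy.\<close>

lift_definition tensor_lift ::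
  "('a::complex_vector \<Rightarrow> 'b::complex_vector \<Rightarrow> 'c::complex_vector) \<Rightarrow> ('a, 'b) tensor \<Rightarrow> 'c"
  is "\<lambda>\<beta> f. if cbilinear \<beta> then free_extend (\<lambda>(a, b) c. c *\<^sub>C \<beta> a b) f else 0"
proof -
  fix \<beta> :: "'a \<Rightarrow> 'b \<Rightarrow> 'c" and f g :: "('a \<times> 'b) \<Rightarrow>\<^sub>0 complex"
  interpret vector_space "scaleC :: complex \<Rightarrow> 'c \<Rightarrow> 'c" by (rule vector_space_scaleC)
  assume "tensor_rel f g"
  then have "free_extend (\<lambda>(a, b) c. c *\<^sub>C \<beta> a b) f = free_extend (\<lambda>(a, b) c. c *\<^sub>C \<beta> a b) g"
    if "cbilinear \<beta>"
    by (rule free_extend_respects)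
      (auto simp: cbilinearD[OF that] scaleC_add_left scaleC_add_right scaleC_scaleC)
  then show "(if cbilinear \<beta> then free_extend (\<lambda>(a, b) c. c *\<^sub>C \<beta> a b) f else 0) =
      (if cbilinear \<beta> then free_extend (\<lambda>(a, b) c. c *\<^sub>C \<beta> a b) g else 0)"
    by simp
qed

lemma tensor_lift_tensor:
  assumes "cbilinear \<beta>"
  shows "tensor_lift \<beta> (a \<otimes>\<^sub>C b) = \<beta> a b"
proof -
  interpret vector_space "scaleC :: complex \<Rightarrow> 'c \<Rightarrow> 'c" by (rule vector_space_scaleC)
  show ?thesis
    using assms by transfer (simp add: free_extend_single scaleC_one)
qed

lemma clinear_tensor_lift: "clinear (tensor_lift \<beta>)"
proof -
  interpret vector_space "scaleC :: complex \<Rightarrow> 'c \<Rightarrow> 'c" by (rule vector_space_scaleC)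
  have add: "tensor_lift \<beta> (s + t) = tensor_lift \<beta> s + tensor_lift \<beta> t" for s t
    by transfer (auto simp: free_extend_add scaleC_add_left split_beta)
  have "tensor_lift \<beta> (z *\<^sub>C t) = z *\<^sub>C tensor_lift \<beta> t" for z t
  proof (transfer fixing: \<beta>)
    fix z f
    have "free_extend (\<lambda>(a, b) c. c *\<^sub>C \<beta> a b) (free_scale z f) =
        z *\<^sub>C free_extend (\<lambda>(a, b) c. c *\<^sub>C \<beta> a b) f"
      by (subst free_extend_superset[where S = "Poly_Mapping.keys f"])
        (auto simp: free_extend_def scale_sum_right scaleC_scaleC split_beta in_keys_iff)
    then show "(if cbilinear \<beta> then free_extend (\<lambda>(a, b) c. c *\<^sub>C \<beta> a b) (free_scale z f) else 0) =
        z *\<^sub>C (if cbilinear \<beta> then free_extend (\<lambda>(a, b) c. c *\<^sub>C \<beta> a b) f else 0)"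
      by simp
  qed
  with add show ?thesis by (simp add: clinear_iff)
qed

definition tensor_map ::
  "('a::complex_vector \<Rightarrow> 'c::complex_vector) \<Rightarrow> ('b::complex_vector \<Rightarrow> 'd::complex_vector)
    \<Rightarrow> ('a, 'b) tensor \<Rightarrow> ('c, 'd) tensor"
  where "tensor_map F G = tensor_lift (\<lambda>a b. F a \<otimes>\<^sub>C G b)"

lemma tensor_map_tensor:
  assumes "clinear F" "clinear G"
  shows "tensor_map F G (a \<otimes>\<^sub>C b) = F a \<otimes>\<^sub>C G b"
  unfolding tensor_map_def
  by (rule tensor_lift_tensor)
    (use assms in \<open>simp add: cbilinear_def clinear_iff tensor_add_left tensor_add_right
      tensor_scaleC_left tensor_scaleC_right\<close>)


section \<open>The *-algebra structure of the tensor product of two *-algebras\<close>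

lift_definition tensor_star ::
  "('a::complex_star_algebra, 'b::complex_star_algebra) tensor \<Rightarrow> ('a, 'b) tensor"
  is "free_extend (\<lambda>(a, b) c. Poly_Mapping.single (star a, star b) (cnj c))"
proof -
  fix f g :: "('a \<times> 'b) \<Rightarrow>\<^sub>0 complex"
  let ?h = "\<lambda>(a :: 'a, b :: 'b) c. Poly_Mapping.single (star a, star b) (cnj c)"
  have add: "free_extend ?h (f + g) = free_extend ?h f + free_extend ?h g" for f g
    by (rule free_extend_add) (auto simp: single_add)
  have single: "free_extend ?h (Poly_Mapping.single p c) = ?h p c" for p c
    by (rule free_extend_single) (auto split: prod.split)
  show "tensor_rel f g \<Longrightarrow> tensor_rel (free_extend ?h f) (free_extend ?h g)"
    by (induction rule: tensor_rel.induct)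
      (auto simp: add single star_add star_scaleC intro: tensor_rel.intros)
qed

lemma tensor_star_tensor: "tensor_star (a \<otimes>\<^sub>C b) = star a \<otimes>\<^sub>C star b"
  by transfer (simp add: free_extend_single tensor_rel_refl)

lemma tensor_star_add: "tensor_star (s + t) = tensor_star s + tensor_star t"
  by transfer (subst free_extend_add, auto simp: single_add tensor_rel_refl)

definition tensor_mult ::
  "('a::complex_star_algebra, 'b::complex_star_algebra) tensor \<Rightarrow> ('a, 'b) tensor \<Rightarrow> ('a, 'b) tensor"
  where "tensor_mult s t =
    tensor_lift (\<lambda>a b. tensor_lift (\<lambda>c d. (a * c) \<otimes>\<^sub>C (b * d)) t) s"

lemma cbilinear_tensor_mult_inner:
  "cbilinear (\<lambda>c d. (a * c) \<otimes>\<^sub>C (b * d) ::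
    ('a::complex_star_algebra, 'b::complex_star_algebra) tensor)"
  by (simp add: cbilinear_def clinear_iff distrib_left mult_scaleC_right tensor_add_left
      tensor_add_right tensor_scaleC_left tensor_scaleC_right)

lemma cbilinear_tensor_mult_outer:
  "cbilinear (\<lambda>a b. tensor_lift (\<lambda>c d. (a * c) \<otimes>\<^sub>C (b * d))
    (t :: ('a::complex_star_algebra, 'b::complex_star_algebra) tensor))"
proof -
  interpret vector_space "scaleC :: complex \<Rightarrow> ('a, 'b) tensor \<Rightarrow> ('a, 'b) tensor"
    by (rule vector_space_scaleC)
  define M where "M a b = tensor_lift (\<lambda>c d. (a * c) \<otimes>\<^sub>C (b * d))" for a :: 'a and b :: 'b
  have "clinear (M a b)" for a b
    unfolding M_def by (rule clinear_tensor_lift)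
  then have M_add: "M a b (s + t) = M a b s + M a b t"
    and M_scaleC: "M a b (z *\<^sub>C t) = z *\<^sub>C M a b t" for a b s t z
    by (simp_all add: clinear_iff)
  have M_0: "M a b 0 = 0" for a b
    using M_add[of a b 0 0] by simp
  have M_tensor: "M a b (c \<otimes>\<^sub>C d) = (a * c) \<otimes>\<^sub>C (b * d)" for a b c d
    unfolding M_def by (rule tensor_lift_tensor[OF cbilinear_tensor_mult_inner])
  have "M (a + a') b t = M a b t + M a' b t" for a a' b
    by (induction t rule: tensor_induct)
      (simp_all add: M_0 M_add M_scaleC M_tensor distrib_right tensor_add_left scaleC_add_right)
  moreover have "M a (b + b') t = M a b t + M a b' t" for a b b'
    by (induction t rule: tensor_induct)
      (simp_all add: M_0 M_add M_scaleC M_tensor distrib_right tensor_add_right scaleC_add_right)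
  moreover have "M (z *\<^sub>C a) b t = z *\<^sub>C M a b t" for z a b
    by (induction t rule: tensor_induct)
      (simp_all add: M_0 M_add M_scaleC M_tensor mult_scaleC_left tensor_scaleC_left
        scaleC_add_right scaleC_scaleC mult.commute)
  moreover have "M a (z *\<^sub>C b) t = z *\<^sub>C M a b t" for z a b
    by (induction t rule: tensor_induct)
      (simp_all add: M_0 M_add M_scaleC M_tensor mult_scaleC_left tensor_scaleC_right
        scaleC_add_right scaleC_scaleC mult.commute)
  ultimately show ?thesis by (simp add: cbilinear_def clinear_iff M_def)
qed

lemma tensor_mult_tensor: "tensor_mult (a \<otimes>\<^sub>C b) (c \<otimes>\<^sub>C d) = (a * c) \<otimes>\<^sub>C (b * d)"
  unfolding tensor_mult_def
  by (subst tensor_lift_tensor[OF cbilinear_tensor_mult_outer])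
    (rule tensor_lift_tensor[OF cbilinear_tensor_mult_inner])


section \<open>Positivity\<close>

text \<open>Positive semidefinite elements of a C*-algebra are the elements of the form \<open>y\<^sup>* y\<close>.\<close>

definition positive_elem :: "'b::complex_star_algebra \<Rightarrow> bool"
  where "positive_elem x \<longleftrightarrow> (\<exists>y. x = star y * y)"

definition positive_map ::
  "('b::complex_star_algebra \<Rightarrow> 'c::complex_star_algebra) \<Rightarrow> bool"
  where "positive_map F \<longleftrightarrow> (\<forall>x. positive_elem x \<longrightarrow> positive_elem (F x))"

text \<open>The algebra of \<open>n \<times> n\<close> matrices over \<open>B\<close> serves as the C*-algebra \<open>B \<otimes> M\<^sub>n\<close>, an
  elementary tensor \<open>b \<otimes> X\<close> being the matrix with entries \<open>X\<^sub>i\<^sub>j b\<close>. Under this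
  identification \<open>F \<otimes> id\<close> is the entrywise application of \<open>F\<close>.\<close>

definition star_mat :: "'b::complex_star_algebra mat \<Rightarrow> 'b mat"
  where "star_mat X = mat (dim_col X) (dim_row X) (\<lambda>(i, j). star (X $$ (j, i)))"

definition positive_mat :: "nat \<Rightarrow> 'b::complex_star_algebra mat \<Rightarrow> bool"
  where "positive_mat n X \<longleftrightarrow> (\<exists>Y \<in> carrier_mat n n. X = star_mat Y * Y)"

definition elementary_mat :: "'b::complex_vector \<Rightarrow> complex mat \<Rightarrow> 'b mat"
  where "elementary_mat b X = map_mat (\<lambda>z. z *\<^sub>C b) X"

abbreviation amplification :: "('b \<Rightarrow> 'c) \<Rightarrow> 'b mat \<Rightarrow> 'c mat"
  where "amplification F \<equiv> map_mat F"

lemma amplification_elementary_mat: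
  assumes "clinear F"
  shows "amplification F (elementary_mat b X) = elementary_mat (F b) X"
  using assms by (auto simp: elementary_mat_def clinear_iff)

definition completely_positive_map ::
  "('b::complex_star_algebra \<Rightarrow> 'c::complex_star_algebra) \<Rightarrow> bool"
  where "completely_positive_map F \<longleftrightarrow>
    (\<forall>n>0. \<forall>X. positive_mat n X \<longrightarrow> positive_mat n (amplification F X))"

definition real_map :: "('b::complex_star_algebra \<Rightarrow> 'c::complex_star_algebra) \<Rightarrow> bool"
  where "real_map F \<longleftrightarrow> (\<forall>b. F (star b) = star (F b))"


section \<open>Quantum sets and quantum graphs\<close>

definition faithful_state :: "('b::cstar_algebra \<Rightarrow> complex) \<Rightarrow> bool"
  where "faithful_state \<psi> \<longleftrightarrow> clinear \<psi> \<and> \<psi> 1 = 1 \<and>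
    (\<forall>x. positive_elem x \<longrightarrow> \<psi> x \<in> \<real>\<^sub>\<ge>\<^sub>0) \<and>
    (\<forall>x. positive_elem x \<and> \<psi> x = 0 \<longrightarrow> x = 0)"

definition inner_L2 :: "('b::cstar_algebra \<Rightarrow> complex) \<Rightarrow> 'b \<Rightarrow> 'b \<Rightarrow> complex"
  where "inner_L2 \<psi> x y = \<psi> (star x * y)"

definition tensor_functional ::
  "('b::complex_vector \<Rightarrow> complex) \<Rightarrow> ('c::complex_vector \<Rightarrow> complex) \<Rightarrow> ('b, 'c) tensor \<Rightarrow> complex"
  where "tensor_functional \<phi> \<psi> = tensor_lift (\<lambda>a b. \<phi> a * \<psi> b)"

definition inner_L2_tensor ::
  "('b::cstar_algebra \<Rightarrow> complex) \<Rightarrow> ('b, 'b) tensor \<Rightarrow> ('b, 'b) tensor \<Rightarrow> complex"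
  where "inner_L2_tensor \<psi> s t = tensor_functional \<psi> \<psi> (tensor_mult (tensor_star s) t)"

definition mult_map :: "('b::complex_star_algebra, 'b) tensor \<Rightarrow> 'b"
  where "mult_map = tensor_lift (*)"

lemma mult_map_tensor: "mult_map (a \<otimes>\<^sub>C b) = a * b"
  unfolding mult_map_def
  by (rule tensor_lift_tensor)
    (simp add: cbilinear_def clinear_iff distrib_left distrib_right mult_scaleC_left
      mult_scaleC_right)

lemma inner_L2_tensor_tensor:
  assumes "clinear \<psi>"
  shows "inner_L2_tensor \<psi> (a \<otimes>\<^sub>C b) (c \<otimes>\<^sub>C d) = inner_L2 \<psi> a c * inner_L2 \<psi> b d"
proof -
  have "cbilinear (\<lambda>a b. \<psi> a * \<psi> b)"
    using assms unfolding cbilinear_def clinear_iff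
    by (simp add: scaleC_complex_def algebra_simps)
  then show ?thesis
    by (simp add: inner_L2_tensor_def inner_L2_def tensor_functional_def tensor_star_tensor
        tensor_mult_tensor tensor_lift_tensor)
qed

definition hilbert_adjoint ::
  "('h \<Rightarrow> 'h \<Rightarrow> complex) \<Rightarrow> ('k \<Rightarrow> 'k \<Rightarrow> complex) \<Rightarrow> ('h \<Rightarrow> 'k) \<Rightarrow> ('k \<Rightarrow> 'h)"
  where "hilbert_adjoint ip\<^sub>H ip\<^sub>K T = (THE T'. \<forall>x y. ip\<^sub>H (T' y) x = ip\<^sub>K y (T x))"

definition mult_adjoint :: "('b::cstar_algebra \<Rightarrow> complex) \<Rightarrow> 'b \<Rightarrow> ('b, 'b) tensor"
  where "mult_adjoint \<psi> = hilbert_adjoint (inner_L2_tensor \<psi>) (inner_L2 \<psi>) mult_map"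

definition delta_form :: "real \<Rightarrow> ('b::fd_cstar_algebra \<Rightarrow> complex) \<Rightarrow> bool"
  where "delta_form \<delta> \<psi> \<longleftrightarrow> \<delta> > 0 \<and> faithful_state \<psi> \<and>
    (\<forall>x. mult_map (mult_adjoint \<psi> x) = complex_of_real (\<delta>\<^sup>2) *\<^sub>C x)"

locale quantum_set =
  fixes \<psi> :: "'b::fd_cstar_algebra \<Rightarrow> complex" and \<delta> :: real
  assumes delta_form: "delta_form \<delta> \<psi>"

locale quantum_graph = quantum_set \<psi> \<delta>
  for \<psi> :: "'b::fd_cstar_algebra \<Rightarrow> complex" and \<delta> :: real +
  fixes A :: "'b \<Rightarrow> 'b"
  assumes clinear_A: "clinear A"
    and schur_idempotent:
      "mult_map (tensor_map A A (mult_adjoint \<psi> x)) = complex_of_real (\<delta>\<^sup>2) *\<^sub>C A x"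

end

theory Submission
  imports Defs "HOL-Computational_Algebra.Fundamental_Theorem_Algebra"
    "HOL-Library.Function_Algebras"
begin

text \<open>The only implication with real content is that a real \<open>A\<close> is completely positive. The other
  two are soft: complete positivity contains positivity as the case of \<open>1 \<times> 1\<close> matrices, and a
  positive map is real because the squares \<open>y\<^sup>* y\<close> span the algebra and are sent to self-adjoint
  elements (\<open>positive_imp_real\<close>).

  For the main implication, the comultiplication \<open>m\<^sup>\<dagger>\<close> is written in manifestly positive form. The
  state need not be a trace, so besides \<open>\<psi>(x\<^sup>* y)\<close> there is a second inner product
  \<open>\<psi>(y x\<^sup>*)\<close>. If \<open>Z\<close> is an orthonormal basis for this second one, then
  \<open>m\<^sup>\<dagger>(x\<^sup>* y) = \<Sum>z\<in>Z. (z x)\<^sup>* \<otimes> (z y)\<close>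
  (\<open>mult_adjoint_expansion\<close>). The adjunction reduces to the expansion
  \<open>a = \<Sum>z\<in>Z. \<psi>(a z\<^sup>*) z\<close>.
  Inserting this in \<open>\<delta>\<^sup>2 A = m(A \<otimes> A)m\<^sup>\<dagger>\<close> and using reality gives
  \<open>\<delta>\<^sup>2 A(x\<^sup>* y) = \<Sum>z\<in>Z. A(z x)\<^sup>* A(z y)\<close>.
  Hence the amplification of \<open>A\<close> maps \<open>Y\<^sup>* Y\<close> to a Gram matrix with entries
  \<open>\<Sum>r. C\<^sub>r\<^sub>i\<^sup>* C\<^sub>r\<^sub>j\<close>, where \<open>r\<close> runs in general over more than \<open>n\<close> indices.

  What remains is that such a Gram matrix is of the form \<open>W\<^sup>* W\<close> with \<open>W\<close> of size
  \<open>n \<times> n\<close> (\<open>positive_mat_Gram\<close>). The matrix acts on the columns \<open>B\<^sup>n\<close> as a self-adjoint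
  nonnegative operator \<open>T\<close> for the inner product built from \<open>\<psi>\<close>. In finite dimension a square root
  of \<open>T\<close> is a real polynomial in \<open>T\<close> (\<open>positive_operator_sqrt\<close>). Being a polynomial in \<open>T\<close>, it is
  also self-adjoint for the \<open>B\<close>-valued inner product on \<open>B\<^sup>n\<close>, and its values on the standard
  columns are the columns of \<open>W\<close>.\<close>

section \<open>Linear algebra over the complex numbers\<close>

interpretation cvs: vector_space "scaleC :: complex \<Rightarrow> 'a \<Rightarrow> 'a::complex_vector"
  by (rule vector_space_scaleC)

lemma clinearD:
  assumes "clinear f"
  shows "f (x + y) = f x + f y" "f (c *\<^sub>C x) = c *\<^sub>C f x" "f 0 = 0" "f (- x) = - f x"
    "f (x - y) = f x - f y" "f (sum g I) = (\<Sum>i\<in>I. f (g i))"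
proof -
  interpret l: Vector_Spaces.linear scaleC scaleC f by (rule assms)
  show "f (x + y) = f x + f y" "f (c *\<^sub>C x) = c *\<^sub>C f x" "f 0 = 0" "f (- x) = - f x"
    "f (x - y) = f x - f y" "f (sum g I) = (\<Sum>i\<in>I. f (g i))"
    by (simp_all add: l.add l.scale l.zero l.neg l.diff l.sum)
qed

text \<open>Only semidefiniteness is built in, because the form on columns in \<open>positive_mat_Gram\<close> sees only
  finitely many coordinates; definiteness is assumed where it holds.\<close>

locale hermitian_form =
  fixes ip :: "'v::complex_vector \<Rightarrow> 'v \<Rightarrow> complex"
  assumes add_right: "ip x (y + z) = ip x y + ip x z"
    and scale_right: "ip x (c *\<^sub>C y) = c * ip x y"
    and cnj_sym: "cnj (ip x y) = ip y x"
    and nonneg: "ip x x \<in> \<real>\<^sub>\<ge>\<^sub>0"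
begin

lemma add_left: "ip (x + y) z = ip x z + ip y z"
  by (metis add_right cnj_sym complex_cnj_add)

lemma scale_left: "ip (c *\<^sub>C x) y = cnj c * ip x y"
  by (metis scale_right cnj_sym complex_cnj_mult)

lemma zero_right [simp]: "ip x 0 = 0"
  using add_right[of x 0 0] by simp

lemma sum_right: "ip x (\<Sum>i\<in>I. f i) = (\<Sum>i\<in>I. ip x (f i))"
  by (induction I rule: infinite_finite_induct) (simp_all add: add_right)

lemma diff_right: "ip x (y - z) = ip x y - ip x z"
  by (metis add_diff_cancel_left' add_right diff_add_cancel)

text \<open>The existence of an orthonormal basis, in the form of an expansion of the given vectors.
  Adding a vector \<open>g\<close> means normalising its component \<open>h\<close> orthogonal to the previous ones.\<close>

lemma Gram_Schmidt:
  assumes definite: "\<And>x. ip x x = 0 \<Longrightarrow> x = 0" and "finite G"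
  shows "\<exists>Z. finite Z \<and> (\<forall>z\<in>Z. \<forall>w\<in>Z. ip z w = (if z = w then 1 else 0)) \<and>
    (\<forall>g\<in>G. g = (\<Sum>z\<in>Z. ip z g *\<^sub>C z))"
  using \<open>finite G\<close>
proof (induction G rule: finite_induct)
  case empty
  show ?case by (intro exI[of _ "{}"]) simp
next
  case (insert g G)
  then obtain Z where fin: "finite Z"
    and on: "\<And>z w. z \<in> Z \<Longrightarrow> w \<in> Z \<Longrightarrow> ip z w = (if z = w then 1 else 0)"
    and exp: "\<And>g. g \<in> G \<Longrightarrow> g = (\<Sum>z\<in>Z. ip z g *\<^sub>C z)" by auto
  define h where "h = g - (\<Sum>z\<in>Z. ip z g *\<^sub>C z)"
  have orth: "ip z h = 0" if "z \<in> Z" for z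
  proof -
    have "ip z (\<Sum>w\<in>Z. ip w g *\<^sub>C w) = (\<Sum>w\<in>Z. if w = z then ip w g else 0)"
      unfolding sum_right scale_right using on[OF that] by (intro sum.cong) auto
    also have "\<dots> = ip z g" using that fin by simp
    finally show ?thesis by (simp add: h_def diff_right)
  qed
  show ?case
  proof (cases "h = 0")
    case True
    with exp on fin show ?thesis by (intro exI[of _ Z]) (auto simp: h_def)
  next
    case False
    obtain a where a: "ip h h = complex_of_real a" "a \<ge> 0"
      using nonneg by (rule nonneg_Reals_cases)
    have "a > 0" using a definite[of h] False by (cases "a = 0") auto
    define e where "e = complex_of_real (1 / sqrt a) *\<^sub>C h"
    have "complex_of_real (sqrt a) * complex_of_real (sqrt a) = complex_of_real a"
      using \<open>a \<ge> 0\<close> by (simp flip: of_real_mult)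
    then have ee: "ip e e = 1" and eh: "ip e h *\<^sub>C e = h"
      using \<open>a > 0\<close> by (simp_all add: e_def scale_left scale_right a field_simps)
    have ze: "ip z e = 0" if "z \<in> Z" for z
      using orth[OF that] by (simp add: e_def scale_right)
    have ez: "ip e z = 0" if "z \<in> Z" for z
      using ze[OF that] cnj_sym[of z e] by simp
    have "e \<notin> Z" using ee ze by auto
    have eG: "ip e g' = 0" if "g' \<in> G" for g'
      by (subst exp[OF that]) (simp add: sum_right scale_right ez)
    have "ip e g = ip e h" by (simp add: h_def diff_right sum_right scale_right ez)
    then have "g = ip e g *\<^sub>C e + (\<Sum>z\<in>Z. ip z g *\<^sub>C z)"
      using eh by (simp add: h_def)
    with exp on fin ee ze ez eG \<open>e \<notin> Z\<close> show ?thesis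
      by (intro exI[of _ "insert e Z"]) auto
  qed
qed

lemma orthonormal_expansion:
  assumes definite: "\<And>x. ip x x = 0 \<Longrightarrow> x = 0"
    and spanning: "finite G" "\<And>x :: 'v. \<exists>c. x = (\<Sum>s\<in>G. c s *\<^sub>C s)"
  obtains Z where "finite Z" "\<And>x :: 'v. x = (\<Sum>z\<in>Z. ip z x *\<^sub>C z)"
proof -
  obtain Z where "finite Z" and Z: "\<And>g. g \<in> G \<Longrightarrow> g = (\<Sum>z\<in>Z. ip z g *\<^sub>C z)"
    using Gram_Schmidt[OF definite spanning(1)] by blast
  have "x = (\<Sum>z\<in>Z. ip z x *\<^sub>C z)" for x
  proof -
    obtain c where x: "x = (\<Sum>s\<in>G. c s *\<^sub>C s)" using spanning(2) by blast
    have "(\<Sum>z\<in>Z. ip z x *\<^sub>C z) = (\<Sum>z\<in>Z. \<Sum>s\<in>G. (c s * ip z s) *\<^sub>C z)"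
      by (simp add: x sum_right scale_right cvs.scale_sum_left)
    also have "\<dots> = (\<Sum>s\<in>G. c s *\<^sub>C (\<Sum>z\<in>Z. ip z s *\<^sub>C z))"
      by (subst sum.swap) (simp add: cvs.scale_sum_right)
    also have "\<dots> = x"
      using Z by (simp add: x)
    finally show ?thesis ..
  qed
  with \<open>finite Z\<close> that show thesis by blast
qed

end

section \<open>Polynomials in an operator\<close>

definition poly_op :: "('v::complex_vector \<Rightarrow> 'v) \<Rightarrow> complex poly \<Rightarrow> 'v \<Rightarrow> 'v" where
  "poly_op T p = fold_coeffs (\<lambda>a F v. a *\<^sub>C v + T (F v)) p (\<lambda>_. 0)"

context
  fixes T :: "'v::complex_vector \<Rightarrow> 'v"
  assumes T: "clinear T"
begin

lemma poly_op_0 [simp]: "poly_op T 0 v = 0"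
  by (simp add: poly_op_def)

lemma poly_op_pCons: "poly_op T (pCons a p) v = a *\<^sub>C v + T (poly_op T p v)"
  by (cases "pCons a p = 0") (auto simp: poly_op_def clinearD(3)[OF T])

lemma poly_op_add: "poly_op T (p + q) v = poly_op T p v + poly_op T q v"
  by (induction p q rule: poly_induct2)
    (simp_all add: poly_op_pCons clinearD[OF T] scaleC_add_left)

lemma poly_op_smult: "poly_op T (smult c p) v = c *\<^sub>C poly_op T p v"
  by (induction p) (simp_all add: poly_op_pCons clinearD[OF T] scaleC_add_right scaleC_scaleC)

lemma poly_op_mult: "poly_op T (p * q) v = poly_op T p (poly_op T q v)"
  by (induction p) (simp_all add: poly_op_pCons poly_op_add poly_op_smult)

lemma clinear_poly_op: "clinear (poly_op T p)"
  unfolding clinear_iff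
  by (induction p) (simp_all add: poly_op_pCons clinearD[OF T] scaleC_add_right scaleC_scaleC mult.commute)

lemma poly_op_1: "poly_op T 1 v = v"
  by (simp add: one_pCons poly_op_pCons clinearD[OF T] scaleC_one)

lemma poly_op_monom: "poly_op T (monom a n) v = a *\<^sub>C (T ^^ n) v"
  by (induction n) (simp_all add: monom_0 monom_Suc poly_op_pCons clinearD[OF T])

lemma poly_op_sum: "poly_op T (\<Sum>i\<in>I. f i) v = (\<Sum>i\<in>I. poly_op T (f i) v)"
  by (induction I rule: infinite_finite_induct) (simp_all add: poly_op_add)

lemma poly_op_closed:
  assumes "cvs.subspace S" "\<And>v. v \<in> S \<Longrightarrow> T v \<in> S" "v \<in> S"
  shows "poly_op T p v \<in> S"
  using assms
  by (induction p) (auto simp: poly_op_pCons cvs.subspace_add cvs.subspace_scale cvs.subspace_0)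

text \<open>The form may take values in any complex vector space: the lemma serves both the scalar inner
  product on columns and the algebra-valued one. Real coefficients are essential, since the form
  conjugates scalars in its first argument.\<close>

lemma poly_op_real_adjoint:
  fixes form :: "'v \<Rightarrow> 'v \<Rightarrow> 'c::complex_vector"
  assumes form: "\<And>u v w. form (u + v) w = form u w + form v w"
      "\<And>u v w. form u (v + w) = form u v + form u w"
      "\<And>c u v. form (c *\<^sub>C u) v = cnj c *\<^sub>C form u v"
      "\<And>c u v. form u (c *\<^sub>C v) = c *\<^sub>C form u v"
    and adj: "\<And>u v. form (T u) v = form u (T v)"
  shows "form (poly_op T (map_poly complex_of_real q) u) v =
    form u (poly_op T (map_poly complex_of_real q) v)"
proof (induction q arbitrary: u v)
  case 0
  have "form 0 v = 0" "form u 0 = 0"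
    using form(3)[of 0 0 v] form(4)[of u 0 0] by simp_all
  then show ?case by simp
next
  case (pCons a q)
  have comm: "T (poly_op T p v) = poly_op T p (T v)" for p v
    by (induction p) (simp_all add: poly_op_pCons clinearD[OF T])
  show ?case
    by (simp add: map_poly_pCons poly_op_pCons form adj pCons.IH comm)
qed

text \<open>The vectors \<open>v, T v, T\<^sup>2 v, \<dots>\<close> stay in a finite-dimensional space, so one more of them than its
  dimension satisfies a linear relation. A repetition among them is a separate case, because
  linear dependence speaks of sets and not of families.\<close>

lemma annihilating_poly_vector:
  assumes "finite G" "cvs.span G = S" "\<And>v. v \<in> S \<Longrightarrow> T v \<in> S" "v \<in> S"
  shows "\<exists>p\<noteq>0. poly_op T p v = 0"
proof -
  have S: "(T ^^ i) v \<in> S" for i by (induction i) (auto simp: assms)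
  let ?I = "{..card G}"
  show ?thesis
  proof (cases "inj_on (\<lambda>i. (T ^^ i) v) ?I")
    case False
    then obtain i j where ij: "i \<noteq> j" "(T ^^ i) v = (T ^^ j) v" by (auto simp: inj_on_def)
    let ?p = "monom 1 i + monom (- 1) j :: complex poly"
    have "coeff ?p i = 1" using ij by simp
    then have "?p \<noteq> 0" by (metis coeff_0 zero_neq_one)
    moreover have "poly_op T ?p v = 0"
      using ij by (simp add: poly_op_add poly_op_monom)
    ultimately show ?thesis by blast
  next
    case True
    let ?D = "(\<lambda>i. (T ^^ i) v) ` ?I"
    have "card ?D = Suc (card G)" using True by (simp add: card_image)
    then have "cvs.dependent ?D"
      using cvs.independent_span_bound[OF assms(1), of ?D] S assms(2) by fastforce
    then obtain u i where u: "(\<Sum>w\<in>?D. u w *\<^sub>C w) = 0" and i: "i \<in> ?I" "u ((T ^^ i) v) \<noteq> 0"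
      by (auto simp: cvs.dependent_finite)
    let ?p = "\<Sum>i\<in>?I. monom (u ((T ^^ i) v)) i"
    have "coeff ?p i = u ((T ^^ i) v)" using i(1) by (simp add: coeff_sum)
    then have "?p \<noteq> 0" using i(2) by (metis coeff_0)
    moreover have "poly_op T ?p v = 0"
      using u by (simp add: poly_op_sum poly_op_monom sum.reindex[OF True])
    ultimately show ?thesis by blast
  qed
qed

lemma annihilating_poly:
  assumes "finite G" "cvs.span G = S" "\<And>v. v \<in> S \<Longrightarrow> T v \<in> S"
  shows "\<exists>p\<noteq>0. \<forall>v\<in>S. poly_op T p v = 0"
proof -
  have "\<exists>p. p \<noteq> 0 \<and> poly_op T p g = 0" if "g \<in> G" for g
    using annihilating_poly_vector[OF assms, of g] that cvs.span_base assms(2) by blast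
  then obtain P where P: "\<And>g. g \<in> G \<Longrightarrow> P g \<noteq> 0" "\<And>g. g \<in> G \<Longrightarrow> poly_op T (P g) g = 0"
    by metis
  (* Polynomials in T commute, so the product inherits the zeros of each factor. *)
  have kill: "poly_op T (\<Prod>g\<in>G. P g) g = 0" if "g \<in> G" for g
  proof -
    have "(\<Prod>g\<in>G. P g) = (\<Prod>g\<in>G - {g}. P g) * P g"
      using that assms(1) by (simp add: prod.remove mult.commute)
    then show ?thesis by (simp add: poly_op_mult P(2)[OF that] clinearD[OF clinear_poly_op])
  qed
  have "poly_op T (\<Prod>g\<in>G. P g) v = 0" if "v \<in> cvs.span G" for v
    using that
    by (induction rule: cvs.span_induct_alt) (simp_all add: clinearD[OF clinear_poly_op] kill)
  with P(1) assms(1,2) show ?thesis by (intro exI[of _ "\<Prod>g\<in>G. P g"]) auto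
qed

end

lemma real_interpolation:
  fixes h :: "real \<Rightarrow> real"
  assumes "finite F"
  shows "\<exists>q. \<forall>x\<in>F. poly q x = h x"
  using assms
proof (induction F rule: finite_induct)
  case (insert a F)
  then obtain q where q: "\<forall>x\<in>F. poly q x = h x" by blast
  let ?w = "\<Prod>x\<in>F. [:- x, 1:]"
  have "poly ?w a \<noteq> 0" "\<forall>x\<in>F. poly ?w x = 0"
    using insert.hyps by (auto simp: poly_prod)
  then show ?case
    using q by (intro exI[of _ "q + smult ((h a - poly q a) / poly ?w a) ?w"]) auto
qed simp

lemma poly_map_of_real: "poly (map_poly complex_of_real q) (complex_of_real x) = complex_of_real (poly q x)"
  by (induction q) (simp_all add: map_poly_pCons)

text \<open>For a minimal annihilating polynomial \<open>p\<close>, every root is an eigenvalue of \<open>T\<close> on \<open>S\<close> and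
  hence nonnegative. Let the real polynomial \<open>q\<close> interpolate the square root at the roots. Then
  \<open>f = q\<^sup>2 - X\<close> vanishes at all roots of \<open>p\<close>, so \<open>p\<close> divides a power of \<open>f\<close> by the
  Nullstellensatz, and \<open>f(T)\<close> is nilpotent. As it is self-adjoint for a definite form, it is zero.\<close>

lemma positive_operator_sqrt:
  fixes T :: "'v::complex_vector \<Rightarrow> 'v"
  assumes T: "clinear T" and form: "hermitian_form ip"
    and S: "finite G" "cvs.span G = S" "\<And>v. v \<in> S \<Longrightarrow> T v \<in> S"
    and definite: "\<And>v. v \<in> S \<Longrightarrow> ip v v = 0 \<Longrightarrow> v = 0"
    and adj: "\<And>u v. ip (T u) v = ip u (T v)"
    and pos: "\<And>v. ip v (T v) \<in> \<real>\<^sub>\<ge>\<^sub>0"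
  shows "\<exists>q. \<forall>v\<in>S. poly_op T (map_poly complex_of_real q)
    (poly_op T (map_poly complex_of_real q) v) = T v"
proof -
  interpret hermitian_form ip by (rule form)
  have sub: "cvs.subspace S" using S(2) by (metis cvs.subspace_span)
  have closed: "poly_op T r v \<in> S" if "v \<in> S" for r v
    using poly_op_closed[OF T sub S(3) that] .
  define Ann where "Ann p \<longleftrightarrow> p \<noteq> 0 \<and> (\<forall>v\<in>S. poly_op T p v = 0)" for p
  obtain p where p: "Ann p" and min: "\<And>r. Ann r \<Longrightarrow> degree p \<le> degree r"
    using annihilating_poly[OF T S] ex_has_least_nat[of Ann _ degree] unfolding Ann_def by blast
  have p0: "p \<noteq> 0" and pS: "\<And>v. v \<in> S \<Longrightarrow> poly_op T p v = 0"
    using p by (auto simp: Ann_def)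
  have root: "c \<in> \<real>\<^sub>\<ge>\<^sub>0" if "poly p c = 0" for c
  proof (rule ccontr)
    assume c: "c \<notin> \<real>\<^sub>\<ge>\<^sub>0"
    from that obtain r where r: "p = [:- c, 1:] * r" by (auto simp: poly_eq_0_iff_dvd elim: dvdE)
    have "r \<noteq> 0" using p0 r by auto
    have "poly_op T r v = 0" if v: "v \<in> S" for v
    proof (rule ccontr)
      define w where "w = poly_op T r v"
      assume "poly_op T r v \<noteq> 0"
      then have w: "w \<noteq> 0" "w \<in> S" using closed[OF v] by (auto simp: w_def)
      (* The root is an eigenvalue, and \<open>c\<close> is the quotient of two nonnegative numbers. *)
      have "T w = c *\<^sub>C w"
        using pS[OF v] unfolding r poly_op_mult[OF T]
        by (simp add: poly_op_pCons[OF T] poly_op_0[OF T] clinearD[OF T] scaleC_one flip: w_def)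
      then have "c * ip w w \<in> \<real>\<^sub>\<ge>\<^sub>0" using pos[of w] by (simp add: scale_right)
      moreover have "ip w w \<noteq> 0" using definite w by blast
      ultimately have "c \<in> \<real>\<^sub>\<ge>\<^sub>0"
        using nonneg[of w] nonneg_Reals_divide_I[of "c * ip w w" "ip w w"] by simp
      with c show False ..
    qed
    then have "Ann r" using \<open>r \<noteq> 0\<close> by (simp add: Ann_def)
    moreover have "degree p = Suc (degree r)"
      using \<open>r \<noteq> 0\<close> unfolding r by (subst degree_mult_eq) auto
    ultimately show False using min[of r] by simp
  qed
  obtain q :: "real poly" where q: "\<And>x. x \<in> Re ` {c. poly p c = 0} \<Longrightarrow> poly q x = sqrt x"
    using real_interpolation[of "Re ` {c. poly p c = 0}" sqrt] poly_roots_finite[OF p0] by auto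
  define Q where "Q = map_poly complex_of_real q"
  define f where "f = map_poly complex_of_real (q * q - [:0, 1:])"
  have f: "poly f c = 0" if c: "poly p c = 0" for c
  proof -
    obtain x where x: "c = complex_of_real x" "x \<ge> 0" using root[OF c] by (rule nonneg_Reals_cases)
    then have "poly q x = sqrt x" using q c by force
    then show ?thesis unfolding f_def x(1) poly_map_of_real using x(2) by simp
  qed
  have fQ: "f = Q * Q - [:0, 1:]"
    unfolding f_def Q_def by (rule poly_eqI) (simp add: coeff_map_poly coeff_mult coeff_pCons split: nat.split)
  have "p dvd f ^ degree p" using nullstellensatz_univariate[of p f] f p0 by blast
  then have nil: "poly_op T (f ^ degree p) v = 0" if "v \<in> S" for v
    using pS[OF that] by (auto simp: dvd_def mult.commute[of p] poly_op_mult[OF T]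
        clinearD[OF clinear_poly_op[OF T]])
  have fadj: "ip (poly_op T f u) v = ip u (poly_op T f v)" for u v
    unfolding f_def
    by (rule poly_op_real_adjoint[OF T, where form = ip])
      (simp_all add: adj add_left add_right scale_left scale_right scaleC_complex_def)
  have "poly_op T f v = 0" if v: "v \<in> S" for v
  proof -
    (* The squared norm of \<open>f(T)\<^sup>k v\<close> is the product of \<open>f(T)\<^sup>k\<^sup>-\<^sup>1 v\<close> and \<open>f(T)\<^sup>k\<^sup>+\<^sup>1 v\<close>, so the
       exponent can be lowered until it is 1. *)
    have reduce: "poly_op T f v = 0" if "poly_op T (f ^ k) v = 0" "k > 0" for k
      using that
    proof (induction k)
      case (Suc k)
      show ?case
      proof (cases k)
        case 0
        with Suc show ?thesis by simp
      next
        case k: (Suc j)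
        define w where "w = poly_op T (f ^ k) v"
        have "ip w w = ip (poly_op T f (poly_op T (f ^ j) v)) w"
          unfolding w_def k power_Suc poly_op_mult[OF T] ..
        also have "\<dots> = ip (poly_op T (f ^ j) v) (poly_op T (f ^ Suc k) v)"
          by (simp add: fadj w_def poly_op_mult[OF T])
        also have "\<dots> = 0" using Suc.prems by simp
        finally have "w = 0" using definite closed[OF v] by (simp add: w_def)
        with Suc.IH k show ?thesis by (simp add: w_def)
      qed
    qed simp
    show ?thesis
    proof (cases "degree p = 0")
      case True
      then have "v = 0" using nil[OF v] by (simp add: poly_op_1[OF T])
      then show ?thesis by (simp add: clinearD[OF clinear_poly_op[OF T]])
    qed (use reduce nil[OF v] in auto)
  qed
  moreover have "Q * Q = f + [:0, 1:]" by (simp add: fQ)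
  ultimately have "poly_op T Q (poly_op T Q v) = T v" if "v \<in> S" for v
    using that poly_op_mult[OF T, of Q Q v]
    by (simp add: poly_op_add[OF T] poly_op_pCons[OF T] poly_op_0[OF T] clinearD[OF T] scaleC_one)
  then show ?thesis unfolding Q_def by blast
qed

section \<open>Faithful states\<close>

lemma star_zero [simp]: "star (0 :: 'b::complex_star_algebra) = 0"
  using star_add[of "0 :: 'b" 0] by simp

lemma star_one [simp]: "star (1 :: 'b::complex_star_algebra) = 1"
  by (metis mult.left_neutral mult.right_neutral star_mult star_star)

lemma star_sum: "star (\<Sum>i\<in>I. f i) = (\<Sum>i\<in>I. star (f i :: 'b::complex_star_algebra))"
  by (induction I rule: infinite_finite_induct) (simp_all add: star_add)

lemma sum_nonneg_Reals: "(\<And>i. i \<in> I \<Longrightarrow> f i \<in> \<real>\<^sub>\<ge>\<^sub>0) \<Longrightarrow> (\<Sum>i\<in>I. f i :: complex) \<in> \<real>\<^sub>\<ge>\<^sub>0"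
  by (induction I rule: infinite_finite_induct) simp_all

context
  fixes \<psi> :: "'b::cstar_algebra \<Rightarrow> complex"
  assumes \<psi>: "faithful_state \<psi>"
begin

lemma clinear_state: "clinear \<psi>"
  using \<psi> by (simp add: faithful_state_def)

lemma state_scale: "\<psi> (c *\<^sub>C x) = c * \<psi> x"
  using clinearD(2)[OF clinear_state] by (simp add: scaleC_complex_def)

lemmas state_linear = clinearD(1,3,4,5,6)[OF clinear_state] state_scale

lemma state_nonneg: "\<psi> (star x * x) \<in> \<real>\<^sub>\<ge>\<^sub>0"
  using \<psi> by (auto simp: faithful_state_def positive_elem_def)

lemma state_faithful: "\<psi> (star x * x) = 0 \<Longrightarrow> x = 0"
proof -
  assume "\<psi> (star x * x) = 0"
  then have "star x * x = 0"
    using \<psi> by (auto simp: faithful_state_def positive_elem_def)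
  then show "x = 0" using norm_star_mult_self[of x] by simp
qed

text \<open>Polarisation: the values of the state on \<open>(x + 1)\<^sup>*(x + 1)\<close> and \<open>(x + \<i>)\<^sup>*(x + \<i>)\<close> are real.\<close>

lemma state_star: "\<psi> (star x) = cnj (\<psi> x)"
proof -
  have Im: "Im (\<psi> (star y * y)) = 0" for y
    using state_nonneg[of y] by (auto elim: nonneg_Reals_cases)
  have "Im (\<psi> (star x) + \<psi> x) = 0"
    using Im[of "x + 1"] Im[of x] Im[of 1] by (simp add: star_add algebra_simps state_linear)
  moreover have "Im (\<i> * (\<psi> (star x) - \<psi> x)) = 0"
    using Im[of "x + \<i> *\<^sub>C 1"] Im[of x] Im[of 1]
    by (simp add: star_add star_scaleC algebra_simps state_linear mult_scaleC_left
        mult_scaleC_right scaleC_add_right scaleC_scaleC)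
  ultimately show ?thesis by (simp add: complex_eq_iff)
qed

lemma hermitian_inner_L2: "hermitian_form (inner_L2 \<psi>)"
  by unfold_locales
    (simp_all add: inner_L2_def distrib_left state_linear mult_scaleC_right state_nonneg
      star_mult star_star flip: state_star)

text \<open>This is the inner product adapted to \<open>m\<^sup>\<dagger>\<close>; it differs from \<open>inner_L2\<close> unless the state is
  tracial.\<close>

lemma hermitian_right_inner: "hermitian_form (\<lambda>x y. \<psi> (y * star x))"
proof
  show "\<psi> (x * star x) \<in> \<real>\<^sub>\<ge>\<^sub>0" for x
    using state_nonneg[of "star x"] by (simp add: star_star)
qed (simp_all add: distrib_right state_linear mult_scaleC_left star_mult star_star flip: state_star)

end

section \<open>Gram matrices over a finite-dimensional C*-algebra\<close>

instantiation "fun" :: (type, complex_vector) complex_vector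
begin

definition scaleC_fun :: "complex \<Rightarrow> ('a \<Rightarrow> 'b) \<Rightarrow> 'a \<Rightarrow> 'b" where
  "scaleC_fun c f = (\<lambda>x. c *\<^sub>C f x)"

instance
  by standard (simp_all add: scaleC_fun_def fun_eq_iff scaleC_add_right scaleC_add_left
      scaleC_scaleC scaleC_one)

end

lemma sum_fun_apply: "(\<Sum>i\<in>I. f i) x = (\<Sum>i\<in>I. f i x :: 'b::comm_monoid_add)"
  by (induction I rule: infinite_finite_induct) simp_all

text \<open>The module of columns of height \<open>n\<close>, as a subspace of one type that does not depend on \<open>n\<close>.\<close>

definition columns :: "nat \<Rightarrow> (nat \<Rightarrow> 'b::zero) set" where
  "columns n = {v. \<forall>i\<ge>n. v i = 0}"

definition column :: "nat \<Rightarrow> 'b::zero \<Rightarrow> nat \<Rightarrow> 'b" where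
  "column k b = (\<lambda>i. if i = k then b else 0)"

lemma columns_finite_span:
  "\<exists>G :: (nat \<Rightarrow> 'b::fd_cstar_algebra) set. finite G \<and> cvs.span G = columns n"
proof -
  obtain B :: "'b set" where B: "finite B" "\<And>x. \<exists>c. x = (\<Sum>s\<in>B. c s *\<^sub>C s)"
    using finite_dimensional by blast
  let ?G = "(\<lambda>(k, s). column k s) ` ({..<n} \<times> B)"
  have "cvs.subspace (columns n :: (nat \<Rightarrow> 'b) set)"
    by (auto simp: cvs.subspace_def columns_def scaleC_fun_def)
  then have "cvs.span ?G \<subseteq> columns n"
    by (intro cvs.span_minimal) (auto simp: columns_def column_def)
  moreover have "v \<in> cvs.span ?G" if v: "v \<in> columns n" for v
  proof -
    obtain c where c: "\<And>x. x = (\<Sum>s\<in>B. c x s *\<^sub>C s)" using B(2) by metis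
    have "v i = (\<Sum>k<n. \<Sum>s\<in>B. c (v k) s *\<^sub>C column k s) i" for i
    proof -
      have "(\<Sum>k<n. \<Sum>s\<in>B. c (v k) s *\<^sub>C column k s) i =
          (\<Sum>k<n. if k = i then \<Sum>s\<in>B. c (v k) s *\<^sub>C s else 0)"
        unfolding sum_fun_apply by (intro sum.cong) (auto simp: column_def scaleC_fun_def)
      also have "\<dots> = v i"
        using v c[of "v i"] by (auto simp: columns_def)
      finally show ?thesis ..
    qed
    then have "v = (\<Sum>k<n. \<Sum>s\<in>B. c (v k) s *\<^sub>C column k s)" by blast
    also have "\<dots> \<in> cvs.span ?G"
      by (intro cvs.span_sum cvs.span_scale cvs.span_base) auto
    finally show ?thesis .
  qed
  ultimately show ?thesis using B(1) by (intro exI[of _ ?G]) auto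
qed

text \<open>A Gram matrix of any finite number of rows is already one of \<open>n\<close> rows: take \<open>W\<close> to be a square
  root of multiplication by the matrix. The square root is a polynomial in the multiplication operator,
  and its values on the standard columns are the columns of \<open>W\<close>. Faithfulness
  of the state makes the scalar form definite on columns.\<close>

lemma positive_mat_Gram:
  fixes \<psi> :: "'b::fd_cstar_algebra \<Rightarrow> complex"
  assumes \<psi>: "faithful_state \<psi>" and "finite R"
  shows "positive_mat n (mat n n (\<lambda>(i, j). \<Sum>r\<in>R. star (Z r i) * Z r j :: 'b))"
proof -
  define X where "X i j = (\<Sum>r\<in>R. star (Z r i) * Z r j)" for i j
  define T where "T v i = (if i < n then \<Sum>j<n. X i j * v j else 0)" for v :: "nat \<Rightarrow> 'b" and i
  define form where "form u v = (\<Sum>i<n. star (u i) * v i)" for u v :: "nat \<Rightarrow> 'b"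
  define \<zeta> where "\<zeta> r v = (\<Sum>j<n. Z r j * v j)" for r v
  define ip where "ip u v = \<psi> (form u v)" for u v
  note state = state_linear[OF \<psi>]
  have T: "clinear T"
    by (auto simp: clinear_iff T_def fun_eq_iff scaleC_fun_def distrib_left sum.distrib
        mult_scaleC_right cvs.scale_sum_right)
  have form: "form (u + v) w = form u w + form v w" "form u (v + w) = form u v + form u w"
    "form (c *\<^sub>C u) v = cnj c *\<^sub>C form u v" "form u (c *\<^sub>C v) = c *\<^sub>C form u v"
    "star (form u v) = form v u" for u v w c
    by (simp_all add: form_def scaleC_fun_def star_add star_scaleC star_sum star_mult star_star
        distrib_left distrib_right sum.distrib mult_scaleC_right mult_scaleC_left
        cvs.scale_sum_right)
  (* The right-hand side is symmetric in u and v and nonnegative for u = v; this gives both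
     self-adjointness and positivity of T. *)
  have form_T: "form u (T v) = (\<Sum>r\<in>R. star (\<zeta> r u) * \<zeta> r v)" for u v
  proof -
    have "form u (T v) = (\<Sum>i<n. \<Sum>j<n. \<Sum>r\<in>R. star (u i) * star (Z r i) * (Z r j * v j))"
      by (simp add: form_def T_def X_def sum_distrib_left sum_distrib_right mult.assoc)
    also have "\<dots> = (\<Sum>i<n. \<Sum>r\<in>R. \<Sum>j<n. star (u i) * star (Z r i) * (Z r j * v j))"
      by (intro sum.cong refl sum.swap)
    also have "\<dots> = (\<Sum>r\<in>R. \<Sum>i<n. \<Sum>j<n. star (u i) * star (Z r i) * (Z r j * v j))"
      by (rule sum.swap)
    also have "\<dots> = (\<Sum>r\<in>R. star (\<zeta> r u) * \<zeta> r v)"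
      by (simp add: \<zeta>_def star_sum star_mult sum_product)
    finally show ?thesis .
  qed
  have form_adj: "form (T u) v = form u (T v)" for u v
    using form(5)[of v "T u"] by (simp add: form_T star_sum star_mult star_star)
  have ip: "hermitian_form ip"
  proof
    show "ip x x \<in> \<real>\<^sub>\<ge>\<^sub>0" for x
      using state_nonneg[OF \<psi>] by (simp add: ip_def form_def state sum_nonneg_Reals)
  qed (simp_all add: ip_def form state flip: state_star[OF \<psi>])
  have definite: "v = 0" if "v \<in> columns n" "ip v v = 0" for v
  proof -
    have "(\<Sum>i<n. Re (\<psi> (star (v i) * v i))) = 0"
      using that(2) by (simp add: ip_def form_def state flip: Re_sum)
    moreover have ge: "Re (\<psi> (star x * x)) \<ge> 0" "Im (\<psi> (star x * x)) = 0" for x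
      using state_nonneg[OF \<psi>, of x] by (auto elim: nonneg_Reals_cases)
    ultimately have "Re (\<psi> (star (v i) * v i)) = 0" if "i < n" for i
      using that by (simp add: sum_nonneg_eq_0_iff)
    then have "v i = 0" if "i < n" for i
      using that ge(2) by (intro state_faithful[OF \<psi>]) (simp add: complex_eq_iff)
    then show "v = 0"
      using that(1) by (auto simp: columns_def fun_eq_iff not_less[symmetric])
  qed
  have adj: "ip (T u) v = ip u (T v)" for u v by (simp add: ip_def form_adj)
  have pos: "ip v (T v) \<in> \<real>\<^sub>\<ge>\<^sub>0" for v
    using state_nonneg[OF \<psi>] by (simp add: ip_def form_T state sum_nonneg_Reals)
  have TS: "T v \<in> columns n" for v by (simp add: T_def columns_def)
  obtain G :: "(nat \<Rightarrow> 'b) set" where G: "finite G" "cvs.span G = columns n"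
    using columns_finite_span by blast
  obtain q where q: "\<And>v. v \<in> columns n \<Longrightarrow> poly_op T (map_poly complex_of_real q)
      (poly_op T (map_poly complex_of_real q) v) = T v"
    using positive_operator_sqrt[where T = T and ip = ip and G = G and S = "columns n"]
      T ip G TS definite adj pos by blast
  define Q where "Q = poly_op T (map_poly complex_of_real q)"
  have Q: "Q (Q v) = T v" if "v \<in> columns n" for v using q[OF that] by (simp add: Q_def)
  have Q_adj: "form (Q u) v = form u (Q v)" for u v
    unfolding Q_def by (rule poly_op_real_adjoint[OF T, where form = form]) (simp_all add: form form_adj)
  define e :: "nat \<Rightarrow> nat \<Rightarrow> 'b" where "e j = column j 1" for j
  define W where "W = mat n n (\<lambda>(i, j). Q (e j) i)"
  (* The algebra-valued form of two standard columns after applying Q is the entry of \<open>Q\<^sup>2 = T\<close>. *)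
  have "X i j = (\<Sum>k<n. star (Q (e i) k) * Q (e j) k)" if "i < n" "j < n" for i j
  proof -
    have e: "e j \<in> columns n" using that by (auto simp: e_def column_def columns_def)
    have "(\<Sum>k<n. star (Q (e i) k) * Q (e j) k) = form (e i) (Q (Q (e j)))"
      using Q_adj[of "e i" "Q (e j)"] by (simp add: form_def)
    also have "\<dots> = form (e i) (T (e j))" by (simp add: Q[OF e])
    also have "\<dots> = (\<Sum>k<n. if k = i then T (e j) k else 0)"
      unfolding form_def by (intro sum.cong) (auto simp: e_def column_def)
    also have "\<dots> = (\<Sum>k<n. X i k * e j k)"
      using that by (simp add: T_def)
    also have "\<dots> = (\<Sum>k<n. if k = j then X i k else 0)"
      by (intro sum.cong) (auto simp: e_def column_def)
    finally show ?thesis using that by simp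
  qed
  then have "mat n n (\<lambda>(i, j). X i j) = star_mat W * W"
    by (intro eq_matI) (auto simp: W_def star_mat_def scalar_prod_def atLeast0LessThan)
  then show ?thesis
    unfolding positive_mat_def X_def by (intro bexI[of _ W]) (auto simp: W_def)
qed

section \<open>The adjoint of the multiplication\<close>

lemma tensor_mult_add_left: "tensor_mult (s + s') t = tensor_mult s t + tensor_mult s' t"
  by (simp add: tensor_mult_def clinearD[OF clinear_tensor_lift])

lemma tensor_mult_scaleC_left: "tensor_mult (c *\<^sub>C s) t = c *\<^sub>C tensor_mult s t"
  by (simp add: tensor_mult_def clinearD[OF clinear_tensor_lift])

lemma clinear_tensor_mult_right:
  "clinear (tensor_mult (s :: ('a::complex_star_algebra, 'b::complex_star_algebra) tensor))"
proof -
  have elem: "tensor_mult (a \<otimes>\<^sub>C b) t = tensor_lift (\<lambda>c d. (a * c) \<otimes>\<^sub>C (b * d)) t"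
    for a b and t :: "('a, 'b) tensor"
    unfolding tensor_mult_def by (rule tensor_lift_tensor[OF cbilinear_tensor_mult_outer])
  have zero: "tensor_mult 0 t = 0" for t :: "('a, 'b) tensor"
    by (simp add: tensor_mult_def clinearD[OF clinear_tensor_lift])
  show ?thesis
    unfolding clinear_iff
    by (induction s rule: tensor_induct)
      (simp_all add: zero tensor_mult_add_left tensor_mult_scaleC_left elem
        clinearD[OF clinear_tensor_lift] scaleC_add_right scaleC_scaleC mult.commute)
qed

lemma tensor_star_scaleC: "tensor_star (c *\<^sub>C t) = cnj c *\<^sub>C tensor_star t"
proof (induction t rule: tensor_induct)
  case zero
  have "tensor_star (0 :: ('a, 'b) tensor) = 0"
    using tensor_star_add[of "0 :: ('a, 'b) tensor" 0] by simp
  then show ?case by simp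
next
  case (tensor d a b)
  have "tensor_star (z *\<^sub>C (a \<otimes>\<^sub>C b)) = cnj z *\<^sub>C tensor_star (a \<otimes>\<^sub>C b)" for z
    by (metis tensor_star_tensor tensor_scaleC_left star_scaleC)
  then show ?case by (simp add: scaleC_scaleC)
next
  case (add s t)
  then show ?case by (simp add: scaleC_add_right tensor_star_add)
qed

context
  fixes \<psi> :: "'b::fd_cstar_algebra \<Rightarrow> complex"
  assumes \<psi>: "faithful_state \<psi>"
begin

lemma inner_L2_tensor_add_left:
  "inner_L2_tensor \<psi> (s + s') t = inner_L2_tensor \<psi> s t + inner_L2_tensor \<psi> s' t"
  by (simp add: inner_L2_tensor_def tensor_functional_def tensor_star_add tensor_mult_add_left
      clinearD[OF clinear_tensor_lift])

lemma inner_L2_tensor_scaleC_left: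
  "inner_L2_tensor \<psi> (c *\<^sub>C s) t = cnj c * inner_L2_tensor \<psi> s t"
  by (simp add: inner_L2_tensor_def tensor_functional_def tensor_star_scaleC
      tensor_mult_scaleC_left clinearD[OF clinear_tensor_lift] scaleC_complex_def)

lemma inner_L2_tensor_zero_left: "inner_L2_tensor \<psi> 0 t = 0"
  using inner_L2_tensor_add_left[of 0 0 t] by simp

lemma inner_L2_tensor_sum_left:
  "inner_L2_tensor \<psi> (\<Sum>i\<in>I. f i) t = (\<Sum>i\<in>I. inner_L2_tensor \<psi> (f i) t)"
  by (induction I rule: infinite_finite_induct)
    (simp_all add: inner_L2_tensor_add_left inner_L2_tensor_zero_left)

lemma clinear_inner_L2_tensor_right: "clinear (inner_L2_tensor \<psi> s)"
  by (simp add: clinear_iff inner_L2_tensor_def tensor_functional_def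
      clinearD[OF clinear_tensor_mult_right] clinearD[OF clinear_tensor_lift])

text \<open>Products of orthonormal basis vectors span the tensor product and are orthonormal there, so an
  element is the sum of its coefficients against them. It suffices to verify this expansion on
  elementary tensors.\<close>

lemma inner_L2_tensor_nondegenerate:
  assumes eq: "\<And>a b. inner_L2_tensor \<psi> s (a \<otimes>\<^sub>C b) = inner_L2_tensor \<psi> t (a \<otimes>\<^sub>C b)"
  shows "s = t"
proof -
  interpret hermitian_form "inner_L2 \<psi>" by (rule hermitian_inner_L2[OF \<psi>])
  obtain B :: "'b set" where B: "finite B" "\<And>x. \<exists>c. x = (\<Sum>s\<in>B. c s *\<^sub>C s)"
    using finite_dimensional by blast
  have definite: "x = 0" if "inner_L2 \<psi> x x = 0" for x
    using that state_faithful[OF \<psi>] by (simp add: inner_L2_def)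
  obtain Z where "finite Z" and Z: "\<And>x. x = (\<Sum>z\<in>Z. inner_L2 \<psi> z x *\<^sub>C z)"
    using orthonormal_expansion[OF definite B] by blast
  have expansion: "t = (\<Sum>z\<in>Z. \<Sum>w\<in>Z. cnj (inner_L2_tensor \<psi> t (z \<otimes>\<^sub>C w)) *\<^sub>C (z \<otimes>\<^sub>C w))" for t
  proof (induction t rule: tensor_induct)
    case zero
    show ?case by (simp add: inner_L2_tensor_zero_left)
  next
    case (tensor c a b)
    have "c *\<^sub>C (a \<otimes>\<^sub>C b) = c *\<^sub>C ((\<Sum>z\<in>Z. inner_L2 \<psi> z a *\<^sub>C z) \<otimes>\<^sub>C (\<Sum>w\<in>Z. inner_L2 \<psi> w b *\<^sub>C w))"
      by (simp flip: Z)
    also have "\<dots> = (\<Sum>z\<in>Z. \<Sum>w\<in>Z. (c * (inner_L2 \<psi> z a * inner_L2 \<psi> w b)) *\<^sub>C (z \<otimes>\<^sub>C w))"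
    proof -
      have left: "(\<Sum>z\<in>Z. f z) \<otimes>\<^sub>C y = (\<Sum>z\<in>Z. f z \<otimes>\<^sub>C y)" for f and y :: 'b
        using clinearD(6)[of "\<lambda>x. x \<otimes>\<^sub>C y" f Z]
        by (simp add: clinear_iff tensor_add_left tensor_scaleC_left)
      have right: "y \<otimes>\<^sub>C (\<Sum>z\<in>Z. f z) = (\<Sum>z\<in>Z. y \<otimes>\<^sub>C f z)" for f and y :: 'b
        using clinearD(6)[of "\<lambda>x. y \<otimes>\<^sub>C x" f Z]
        by (simp add: clinear_iff tensor_add_right tensor_scaleC_right)
      show ?thesis
        by (simp add: left right tensor_scaleC_left tensor_scaleC_right cvs.scale_sum_right
            scaleC_scaleC) (subst sum.swap, simp add: mult.commute)
    qed
    also have "\<dots> = (\<Sum>z\<in>Z. \<Sum>w\<in>Z. cnj (inner_L2_tensor \<psi> (c *\<^sub>C (a \<otimes>\<^sub>C b)) (z \<otimes>\<^sub>C w)) *\<^sub>C (z \<otimes>\<^sub>C w))"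
      by (simp add: inner_L2_tensor_scaleC_left inner_L2_tensor_tensor[OF clinear_state[OF \<psi>]] cnj_sym)
    finally show ?case .
  next
    case (add s t)
    show ?case
      by (subst add.IH(1), subst add.IH(2))
        (simp add: inner_L2_tensor_add_left scaleC_add_left sum.distrib)
  qed
  show ?thesis
    by (subst expansion[of s], subst expansion[of t]) (simp add: eq)
qed

text \<open>Adjoints are given by a definite description, so a candidate is identified by the
  adjunction on elementary tensors together with nondegeneracy.\<close>

lemma mult_adjoint_eqI:
  assumes "\<And>p a b. inner_L2_tensor \<psi> (F p) (a \<otimes>\<^sub>C b) = inner_L2 \<psi> p (a * b)"
  shows "mult_adjoint \<psi> = F"
  unfolding mult_adjoint_def hilbert_adjoint_def
proof (rule the_equality)
  have lin: "clinear mult_map" unfolding mult_map_def by (rule clinear_tensor_lift)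
  show "\<forall>x p. inner_L2_tensor \<psi> (F p) x = inner_L2 \<psi> p (mult_map x)"
  proof (intro allI)
    interpret hermitian_form "inner_L2 \<psi>" by (rule hermitian_inner_L2[OF \<psi>])
    show "inner_L2_tensor \<psi> (F p) x = inner_L2 \<psi> p (mult_map x)" for p x
      by (induction x rule: tensor_induct)
        (simp_all add: clinearD[OF lin] clinearD[OF clinear_inner_L2_tensor_right] mult_map_tensor
          assms add_right scale_right scaleC_complex_def)
  qed
next
  fix F'
  assume "\<forall>x p. inner_L2_tensor \<psi> (F' p) x = inner_L2 \<psi> p (mult_map x)"
  then show "F' = F"
    by (intro ext inner_L2_tensor_nondegenerate) (simp add: assms mult_map_tensor)
qed

text \<open>Pairing the right-hand side with \<open>a \<otimes> b\<close> produces, up to conjugation,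
  \<open>\<Sum>z. \<psi>(a\<^sup>* x\<^sup>* z\<^sup>*) \<psi>(b\<^sup>* z y)\<close>. For an orthonormal basis of \<open>\<psi>(y x\<^sup>*)\<close> the sum
  \<open>\<Sum>z. \<psi>(a\<^sup>* x\<^sup>* z\<^sup>*) z\<close> collapses to \<open>a\<^sup>* x\<^sup>*\<close>, which leaves \<open>\<psi>((a b)\<^sup>* x\<^sup>* y)\<close>.\<close>

lemma mult_adjoint_expansion:
  obtains Z where "finite Z"
    "\<And>x y. mult_adjoint \<psi> (star x * y) = (\<Sum>z\<in>Z. star (z * x) \<otimes>\<^sub>C (z * y))"
proof -
  interpret R: hermitian_form "\<lambda>x y. \<psi> (y * star x)" by (rule hermitian_right_inner[OF \<psi>])
  note state = state_linear[OF \<psi>]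
  obtain B :: "'b set" where B: "finite B" "\<And>x. \<exists>c. x = (\<Sum>s\<in>B. c s *\<^sub>C s)"
    using finite_dimensional by blast
  have definite: "x = 0" if "\<psi> (x * star x) = 0" for x
    using state_faithful[OF \<psi>, of "star x"] that by (metis star_star star_zero)
  obtain Z where "finite Z" and Z: "\<And>x. x = (\<Sum>z\<in>Z. \<psi> (x * star z) *\<^sub>C z)"
    using R.orthonormal_expansion[OF definite B] by blast
  have pair: "inner_L2_tensor \<psi> (\<Sum>z\<in>Z. star (z * x) \<otimes>\<^sub>C (z * y)) (a \<otimes>\<^sub>C b) =
    inner_L2 \<psi> (star x * y) (a * b)" for x y a b
  proof -
    have "cnj (inner_L2_tensor \<psi> (\<Sum>z\<in>Z. star (z * x) \<otimes>\<^sub>C (z * y)) (a \<otimes>\<^sub>C b)) =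
        (\<Sum>z\<in>Z. \<psi> (star a * star x * star z) * \<psi> (star b * z * y))"
      by (simp add: inner_L2_tensor_sum_left inner_L2_tensor_tensor[OF clinear_state[OF \<psi>]]
          inner_L2_def star_mult star_star mult.assoc flip: state_star[OF \<psi>])
    also have "\<dots> = \<psi> (star b * (\<Sum>z\<in>Z. \<psi> (star a * star x * star z) *\<^sub>C z) * y)"
      by (simp add: state sum_distrib_left sum_distrib_right mult_scaleC_left mult_scaleC_right)
    also have "\<dots> = \<psi> (star b * (star a * star x) * y)"
      by (simp flip: Z)
    also have "\<dots> = cnj (inner_L2 \<psi> (star x * y) (a * b))"
      by (simp add: inner_L2_def star_mult star_star mult.assoc flip: state_star[OF \<psi>])
    finally show ?thesis by simp
  qed
  (* The case \<open>y = 1\<close> determines the adjoint; the general case follows since \<open>star x * y\<close> does not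
     remember its factorisation. *)
  have adj: "mult_adjoint \<psi> = (\<lambda>p. \<Sum>z\<in>Z. star (z * star p) \<otimes>\<^sub>C (z * 1))"
    using pair[of "star p" 1 for p] by (intro mult_adjoint_eqI) (simp add: star_star)
  have "mult_adjoint \<psi> (star x * y) = (\<Sum>z\<in>Z. star (z * x) \<otimes>\<^sub>C (z * y))" for x y
  proof (rule inner_L2_tensor_nondegenerate)
    fix a b
    show "inner_L2_tensor \<psi> (mult_adjoint \<psi> (star x * y)) (a \<otimes>\<^sub>C b) =
        inner_L2_tensor \<psi> (\<Sum>z\<in>Z. star (z * x) \<otimes>\<^sub>C (z * y)) (a \<otimes>\<^sub>C b)"
      unfolding adj pair by (simp add: star_star)
  qed
  with \<open>finite Z\<close> that show thesis by blast
qed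

end

section \<open>Real quantum graphs\<close>

context quantum_graph
begin

lemma faithful: "faithful_state \<psi>" and delta_pos: "\<delta> > 0"
  using delta_form by (simp_all add: delta_form_def)

text \<open>The factor \<open>\<delta>\<^sup>-\<^sup>2\<close> is split evenly between the two factors to keep the sum a Gram sum.\<close>

lemma real_imp_Gram:
  assumes "real_map A"
  obtains Z where "finite Z"
    "\<And>x y. A (star x * y) =
      (\<Sum>z\<in>Z. star (complex_of_real (1 / \<delta>) *\<^sub>C A (z * x)) * (complex_of_real (1 / \<delta>) *\<^sub>C A (z * y)))"
proof -
  obtain Z where Z: "finite Z"
    "\<And>x y. mult_adjoint \<psi> (star x * y) = (\<Sum>z\<in>Z. star (z * x) \<otimes>\<^sub>C (z * y))"
    using mult_adjoint_expansion[OF faithful] by blast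
  have lin: "clinear (tensor_map A A)" "clinear (mult_map :: ('b, 'b) tensor \<Rightarrow> 'b)"
    unfolding tensor_map_def mult_map_def by (rule clinear_tensor_lift)+
  have "complex_of_real (\<delta>\<^sup>2) *\<^sub>C A (star x * y) = (\<Sum>z\<in>Z. star (A (z * x)) * A (z * y))" for x y
    using schur_idempotent[of "star x * y"] assms
    by (simp add: Z(2) clinearD(6)[OF lin(1)] clinearD(6)[OF lin(2)] mult_map_tensor
        tensor_map_tensor[OF clinear_A clinear_A] real_map_def)
  then have "complex_of_real (1 / \<delta>\<^sup>2) *\<^sub>C complex_of_real (\<delta>\<^sup>2) *\<^sub>C A (star x * y) =
      complex_of_real (1 / \<delta>\<^sup>2) *\<^sub>C (\<Sum>z\<in>Z. star (A (z * x)) * A (z * y))" for x y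
    by simp
  then have "A (star x * y) = complex_of_real (1 / \<delta>\<^sup>2) *\<^sub>C (\<Sum>z\<in>Z. star (A (z * x)) * A (z * y))" for x y
    using delta_pos by (simp add: scaleC_scaleC scaleC_one flip: of_real_mult of_real_power)
  then show thesis
    using Z(1) by (intro that[of Z])
      (simp_all add: star_scaleC mult_scaleC_left mult_scaleC_right scaleC_scaleC power2_eq_square cvs.scale_sum_right)
qed

lemma real_imp_completely_positive:
  assumes "real_map A"
  shows "completely_positive_map A"
  unfolding completely_positive_map_def
proof (intro allI impI)
  fix n and X :: "'b mat"
  assume "positive_mat n X"
  then obtain Y where Y: "Y \<in> carrier_mat n n" "X = star_mat Y * Y"
    by (auto simp: positive_mat_def)
  obtain Z where Z: "finite Z" "\<And>x y. A (star x * y) =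
      (\<Sum>z\<in>Z. star (complex_of_real (1 / \<delta>) *\<^sub>C A (z * x)) * (complex_of_real (1 / \<delta>) *\<^sub>C A (z * y)))"
    using real_imp_Gram[OF assms] by blast
  define C where "C r i = complex_of_real (1 / \<delta>) *\<^sub>C A (snd r * Y $$ (fst r, i))" for r :: "nat \<times> 'b" and i
  have "A (\<Sum>l<n. star (Y $$ (l, i)) * Y $$ (l, j)) = (\<Sum>r\<in>{..<n} \<times> Z. star (C r i) * C r j)" for i j
    by (simp add: C_def clinearD(6)[OF clinear_A] Z(2) sum.cartesian_product split_beta)
  then have "amplification A X = mat n n (\<lambda>(i, j). \<Sum>r\<in>{..<n} \<times> Z. star (C r i) * C r j)"
    using Y by (intro eq_matI) (auto simp: star_mat_def scalar_prod_def atLeast0LessThan)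
  then show "positive_mat n (amplification A X)"
    using positive_mat_Gram[OF faithful, of "{..<n} \<times> Z" n C] Z(1) by simp
qed

end

lemma completely_positive_imp_positive:
  assumes "completely_positive_map F"
  shows "positive_map F"
  unfolding positive_map_def
proof (intro allI impI)
  fix x :: 'a
  assume "positive_elem x"
  then obtain y where "x = star y * y" by (auto simp: positive_elem_def)
  then have "mat 1 1 (\<lambda>_. x) = star_mat (mat 1 1 (\<lambda>_. y)) * mat 1 1 (\<lambda>_. y)"
    by (intro eq_matI) (auto simp: star_mat_def scalar_prod_def)
  then have "positive_mat 1 (mat 1 1 (\<lambda>_. x))" by (auto simp: positive_mat_def)
  then have "positive_mat 1 (amplification F (mat 1 1 (\<lambda>_. x)))"
    using assms by (simp add: completely_positive_map_def)
  then obtain W where W: "W \<in> carrier_mat 1 1"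
    "amplification F (mat 1 1 (\<lambda>_. x)) = star_mat W * W"
    by (auto simp: positive_mat_def)
  then have "F x = (star_mat W * W) $$ (0, 0)" by (simp flip: W(2))
  also have "\<dots> = star (W $$ (0, 0)) * W $$ (0, 0)"
    using W(1) by (simp add: star_mat_def scalar_prod_def)
  finally show "positive_elem (F x)" by (auto simp: positive_elem_def)
qed

text \<open>The defect \<open>d(x) = F(x)\<^sup>* - F(x\<^sup>*)\<close> is conjugate-linear and vanishes on squares. Polarising with
  \<open>b + 1\<close> and \<open>b + \<i>\<close> gives \<open>d(b\<^sup>*) = - d(b)\<close> and \<open>d(b\<^sup>*) = d(b)\<close>.\<close>

lemma positive_imp_real:
  assumes F: "clinear F" and pos: "positive_map F"
  shows "real_map F"
proof -
  define d where "d x = star (F x) - F (star x)" for x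
  have d_add: "d (x + y) = d x + d y" and d_scale: "d (c *\<^sub>C x) = cnj c *\<^sub>C d x" for x y c
    by (simp_all add: d_def clinearD[OF F] star_add star_scaleC cvs.scale_right_diff_distrib)
  have d_minus: "d (- x) = - d x" for x
    using d_scale[of "- 1" x] by (simp add: scaleC_one)
  have square: "d (star y * y) = 0" for y
  proof -
    obtain w where "F (star y * y) = star w * w"
      using pos by (auto simp: positive_map_def positive_elem_def)
    then show ?thesis by (simp add: d_def star_mult star_star)
  qed
  have "d b = 0" for b
  proof -
    have "d (star b * b) + d (star b) + d b + d 1 = d (star (b + 1) * (b + 1))"
      by (simp add: star_add distrib_left distrib_right add_ac flip: d_add)
    then have plus: "d (star b) + d b = 0"
      using square[of b] square[of 1] square[of "b + 1"] by simp
    have "star (b + \<i> *\<^sub>C 1) * (b + \<i> *\<^sub>C 1) = star b * b + \<i> *\<^sub>C star b + (- \<i>) *\<^sub>C b + 1"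
      by (simp add: star_add star_scaleC mult_scaleC_left mult_scaleC_right scaleC_scaleC
          scaleC_one cvs.scale_right_diff_distrib algebra_simps)
    then have "d (star b * b) + d (\<i> *\<^sub>C star b) + d ((- \<i>) *\<^sub>C b) + d 1 = 0"
      using square[of "b + \<i> *\<^sub>C 1"] by (simp flip: d_add)
    then have "\<i> *\<^sub>C (d b - d (star b)) = 0"
      using square[of b] square[of 1] by (simp add: d_minus d_scale cvs.scale_right_diff_distrib)
    then have "d b = d (star b)" by simp
    with plus have "2 *\<^sub>C d b = 0"
      by (metis scaleC_add_left scaleC_one one_add_one)
    then show ?thesis by simp
  qed
  then show ?thesis by (simp add: real_map_def d_def)
qed

theorem proposition2p23:
  fixes \<psi> :: "'b::fd_cstar_algebra \<Rightarrow> complex" and \<delta> :: real and A :: "'b \<Rightarrow> 'b"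
  assumes "quantum_graph \<psi> \<delta> A"
  shows "(real_map A \<longleftrightarrow> positive_map A) \<and> (positive_map A \<longleftrightarrow> completely_positive_map A)"
  using quantum_graph.real_imp_completely_positive[OF assms] completely_positive_imp_positive
    positive_imp_real[OF quantum_graph.clinear_A[OF assms]] by blast

end
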